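(* Let $m$ be a non-negative integer and $\alpha>0$. For $z\in\mathbb{C}$ with $|z|<1$, $$\big(C_m^{(\alpha)}(1-2z)\big)^2=\Big(\frac{(2\alpha)_m}{m!}\Big)^2F^2\left(-m,m+2\alpha;\alpha+\tfrac12;z\right)=\Big(\frac{(2\alpha)_m}{m!}\Big)^2\sum_{n=0}^\infty u_n z^n,$$ where $u_0=1$, $u_1=-4m(2\alpha+m)/(2\alpha+1)$ and, for all $n\ge1$, $$\begin{aligned}u_{n+1}={}&\frac{n\left(2\alpha(8\alpha-3)-8m^2-16\alpha m+1\right)-8\alpha m(2\alpha+m)+4n^3+3(6\alpha-1)n^2}{(n+1)(2\alpha+n)(2\alpha+2n+1)}u_n\\&-\frac{2(-2m+n-1)(2\alpha+n-1)(4\alpha+2m+n-1)}{(n+1)(2\alpha+n)(2\alpha+2n+1)}u_{n-1}.\end{aligned}$$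
   Context: $C_m^{(\alpha)}$ is the Gegenbauer polynomial, with generating function $(1-2xt+t^2)^{-\alpha}=\sum_{m\ge0}C_m^{(\alpha)}(x)t^m$. $F(a,b;c;z)=\sum_{k=0}^\infty \frac{(a)_k(b)_k}{(c)_k\,k!}z^k$, $|z|<1$, is the Gaussian hypergeometric function, with $(x)_k=x(x+1)\cdots(x+k-1)$, $(x)_0=1$; $F^2$ denotes its square. *)

theory Defs
  imports "HOL-Complex_Analysis.Complex_Analysis"
begin

text \<open>
  The coefficient of \<open>t\<^sup>m\<close> in \<open>(1 - 2 x t + t\<^sup>2) powr (-\<alpha>)\<close>, expanded as a formal power series
  in \<open>t\<close>: \<^term>\<open>fps_binomial (- \<alpha>)\<close> is the binomial series of \<open>(1 + X) powr (-\<alpha>)\<close>, into which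
  \<open>t\<^sup>2 - 2 x t\<close> is substituted.
\<close>
definition gegenbauer :: "nat \<Rightarrow> 'a::field_char_0 \<Rightarrow> 'a \<Rightarrow> 'a" where
  "gegenbauer m \<alpha> x =
     fps_nth (fps_compose (fps_binomial (- \<alpha>)) (fps_X ^ 2 - fps_const (2 * x) * fps_X)) m"

text \<open>The formal expansion agrees with the analytic one (principal branch) near \<open>t = 0\<close>.\<close>
lemma gegenbauer_generating_function:
  fixes \<alpha> x :: complex
  shows "(\<lambda>t. (1 - 2 * x * t + t ^ 2) powr (- \<alpha>)) has_fps_expansion
           Abs_fps (\<lambda>m. gegenbauer m \<alpha> x)"
proof -
  let ?G = "fps_X ^ 2 - fps_const (2 * x) * fps_X :: complex fps"
  have "fps_conv_radius (fps_binomial (- \<alpha>)) \<ge> 1"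
    unfolding fps_conv_radius_def
    by (rule conv_radius_geI_ex') (auto intro!: sums_summable[OF gen_binomial_complex])
  moreover have "eventually (\<lambda>z. eval_fps (fps_binomial (- \<alpha>)) z = (1 + z) powr (- \<alpha>)) (nhds 0)"
  proof -
    have "eventually (\<lambda>z::complex. z \<in> ball 0 1) (nhds 0)"
      by (rule eventually_nhds_in_open) auto
    thus ?thesis
      by eventually_elim (auto simp: eval_fps_def intro!: sums_unique[symmetric] gen_binomial_complex)
  qed
  ultimately have "(\<lambda>z. (1 + z) powr (- \<alpha>)) has_fps_expansion fps_binomial (- \<alpha>)"
    unfolding has_fps_expansion_def by (auto intro: less_le_trans[of 0 "1::ereal"])
  moreover have "(\<lambda>t. t ^ 2 - (2 * x) * t) has_fps_expansion ?G"
    by (intro fps_expansion_intros)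
  ultimately have "((\<lambda>z. (1 + z) powr (- \<alpha>)) \<circ> (\<lambda>t. t ^ 2 - (2 * x) * t)) has_fps_expansion
                     fps_compose (fps_binomial (- \<alpha>)) ?G"
    by (rule has_fps_expansion_compose) simp
  moreover have "Abs_fps (\<lambda>m. gegenbauer m \<alpha> x) = fps_compose (fps_binomial (- \<alpha>)) ?G"
    by (simp add: fps_eq_iff gegenbauer_def)
  ultimately show ?thesis
    by (simp add: o_def algebra_simps)
qed

definition hyp2F1 :: "complex \<Rightarrow> complex \<Rightarrow> complex \<Rightarrow> complex \<Rightarrow> complex" where
  "hyp2F1 a b c z = (\<Sum>k. pochhammer a k * pochhammer b k / (pochhammer c k * fact k) * z ^ k)"

lemma hyp2F1_eq_eval_fps_hypergeo: "hyp2F1 a b c z = eval_fps (fps_hypergeo [a, b] [c] 1) z"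
  by (simp add: hyp2F1_def eval_fps_def)

end

theory Submission
  imports Defs
begin

text \<open>
  Two independent facts make the theorem work.

  \<^emph>\<open>The Gegenbauer polynomial is a terminating hypergeometric series.\<close> With \<open>x = 1 - 2 z\<close> the base of
  the generating function factors as
  \<open>1 - 2 x t + t\<^sup>2 = (1 - t)\<^sup>2 (1 + 4 z t / (1 - t)\<^sup>2)\<close>.
  Raising to the power \<open>-\<alpha>\<close> and expanding only the second factor by the binomial series gives
  \<open>\<Sum>k. (-\<alpha> gchoose k) (4 z t)\<^sup>k (1 - t) powr (- 2 \<alpha> - 2 k)\<close>, whose coefficient of \<open>t\<^sup>m\<close> is an explicit
  polynomial in \<open>z\<close>; the duplication formula for the Pochhammer symbol turns its coefficients into
  those of \<open>F\<close>. All of this takes place in the ring of formal power series in \<open>t\<close>, where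
  \<open>(1 + A) powr a\<close> means the composition of the binomial series with \<open>A\<close>. The one nontrivial
  ingredient there is \<open>((1 + A) (1 + B)) powr a = (1 + A) powr a * (1 + B) powr a\<close>
  (\<open>fps_binomial_compose_mult\<close>), which holds because both sides have the same logarithmic derivative.

  \<^emph>\<open>The square of \<open>F\<close> solves a third-order equation.\<close> Here the parameters satisfy \<open>2 c = a + b + 1\<close>, so
  with \<open>p = z (1 - z)\<close> the hypergeometric equation is \<open>p f'' + c p' f' - a b f = 0\<close>. Products of two
  solutions of a linear second-order equation satisfy a linear third-order equation, and in the
  present case the coefficients of that equation for \<open>w = f\<^sup>2\<close> are built from \<open>p\<^sup>2\<close>, \<open>p p'\<close>, \<open>p\<close>, \<open>p'\<^sup>2\<close> and \<open>p'\<close>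
  (\<open>hypergeo_square_ode\<close>). Reading off the coefficient of \<open>z\<^sup>n\<close> relates only \<open>w\<^sub>n\<^sub>-\<^sub>1\<close>, \<open>w\<^sub>n\<close> and
  \<open>w\<^sub>n\<^sub>+\<^sub>1\<close>, and for \<open>a = - m\<close>, \<open>b = m + 2 \<alpha>\<close> this is the stated recurrence. Hence \<open>u\<close> is the
  coefficient sequence of \<open>F\<^sup>2\<close>, and since \<open>F\<close> is a polynomial, the series converges everywhere.
\<close>

unbundle no vec_syntax

section \<open>Multiplicativity of the formal binomial series\<close>

lemma one_plus_X_times_fps_binomial_deriv:
  "(1 + fps_X) * fps_deriv (fps_binomial a) = fps_const a * fps_binomial (a :: 'a :: field_char_0)"
proof -
  have "(1 + fps_X :: 'a fps) \<noteq> 0" "is_unit (1 + fps_X :: 'a fps)" by auto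
  thus ?thesis by (simp add: fps_binomial_deriv)
qed

text \<open>
  The function \<open>y = (1 + A) powr a\<close> has logarithmic derivative \<open>a A' / (1 + A)\<close>; with the denominator
  cleared, the identity is purely polynomial in \<open>A\<close>, \<open>A'\<close>, \<open>y\<close> and \<open>y'\<close>.
\<close>
lemma fps_binomial_compose_ode:
  fixes A :: "'a :: field_char_0 fps"
  assumes "A $ 0 = 0"
  shows "(1 + A) * fps_deriv (fps_binomial a oo A)
           = fps_const a * fps_deriv A * (fps_binomial a oo A)"
proof -
  have "((1 + fps_X) * fps_deriv (fps_binomial a)) oo A = (fps_const a * fps_binomial a) oo A"
    by (simp only: one_plus_X_times_fps_binomial_deriv)
  hence "(1 + A) * (fps_deriv (fps_binomial a) oo A) = fps_const a * (fps_binomial a oo A)"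
    using assms by (simp add: fps_compose_mult_distrib fps_compose_add_distrib)
  thus ?thesis
    by (simp add: fps_compose_deriv[OF assms] mult_ac)
qed

text \<open>
  If \<open>f\<close> and \<open>g\<close> have the same logarithmic derivative \<open>k / h\<close>, then \<open>f / g\<close> has derivative zero. The
  quotient \<open>k / h\<close> is kept as a pair since \<open>h\<close> may fail to be invertible.
\<close>
lemma fps_eq_of_same_log_deriv:
  fixes f g h k :: "'a :: field_char_0 fps"
  assumes "h * fps_deriv f = k * f" "h * fps_deriv g = k * g" "h \<noteq> 0"
    and "f $ 0 = 1" "g $ 0 = 1"
  shows "f = g"
proof -
  have "h * (fps_deriv f * g - f * fps_deriv g) = (h * fps_deriv f) * g - f * (h * fps_deriv g)"
    by (simp add: algebra_simps)
  also have "\<dots> = 0"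
    by (simp add: assms(1,2) algebra_simps)
  finally have wronskian: "fps_deriv f * g - f * fps_deriv g = 0"
    using assms(3) by simp
  have g: "g $ 0 \<noteq> 0" using assms(5) by simp
  have "fps_deriv (f * inverse g) = (fps_deriv f * g - f * fps_deriv g) * inverse g ^ 2"
    using inverse_mult_eq_1[OF g]
    by (simp add: fps_inverse_deriv[OF g] power2_eq_square) algebra
  hence "f * inverse g = fps_const ((f * inverse g) $ 0)"
    by (simp only: wronskian fps_deriv_eq_0_iff mult_zero_left)
  hence "f * inverse g = 1"
    using assms(4,5) by simp
  thus ?thesis
    using inverse_mult_eq_1[OF g] by algebra
qed

text \<open>
  Since \<open>1 + (A + B + A B) = (1 + A) (1 + B)\<close>, this is the law \<open>(u v) powr a = u powr a * v powr a\<close>.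
\<close>
lemma fps_binomial_compose_mult:
  fixes A B :: "'a :: field_char_0 fps"
  assumes A: "A $ 0 = 0" and B: "B $ 0 = 0"
  shows "fps_binomial a oo (A + B + A * B) = (fps_binomial a oo A) * (fps_binomial a oo B)"
proof (rule fps_eq_of_same_log_deriv)
  let ?G = "A + B + A * B"
  have G: "?G $ 0 = 0" using A B by simp
  show "(1 + ?G) * fps_deriv (fps_binomial a oo ?G)
          = (fps_const a * fps_deriv ?G) * (fps_binomial a oo ?G)"
    by (rule fps_binomial_compose_ode[OF G])
  show "(1 + ?G) * fps_deriv ((fps_binomial a oo A) * (fps_binomial a oo B))
          = (fps_const a * fps_deriv ?G) * ((fps_binomial a oo A) * (fps_binomial a oo B))"
    using fps_binomial_compose_ode[OF A, of a] fps_binomial_compose_ode[OF B, of a]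
    by simp algebra
  have "(1 + ?G) $ 0 = 1" by (simp add: A B)
  thus "1 + ?G \<noteq> 0" by force
qed (simp_all add: A B)

section \<open>The generating function in terms of \<open>z = (1 - x) / 2\<close>\<close>

text \<open>
  As \<open>B\<close> has no constant term, \<open>B ^ k\<close> starts in degree \<open>k\<close>. So only \<open>k \<le> m\<close> contributes to degree
  \<open>m\<close>, and the sum can be taken over a range independent of the degrees in the Cauchy product.
\<close>
lemma fps_mult_compose_nth:
  fixes E F B :: "'a :: idom fps"
  assumes "B $ 0 = 0"
  shows "(E * (F oo B)) $ m = (\<Sum>k\<le>m. F $ k * (E * B ^ k) $ m)"
proof -
  have "(F oo B) $ j = (\<Sum>k\<le>m. F $ k * (B ^ k) $ j)" if "j \<le> m" for j
    unfolding fps_compose_nth using that startsby_zero_power_prefix[OF assms]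
    by (intro sum.mono_neutral_left) auto
  hence "(E * (F oo B)) $ m = (\<Sum>i=0..m. \<Sum>k\<le>m. F $ k * (E $ i * (B ^ k) $ (m - i)))"
    by (simp add: fps_mult_nth sum_distrib_left mult_ac)
  also have "\<dots> = (\<Sum>k\<le>m. F $ k * (E * B ^ k) $ m)"
    by (subst sum.swap) (simp add: fps_mult_nth sum_distrib_left)
  finally show ?thesis .
qed

text \<open>
  The formal version of \<open>(1 - X) powr (- s)\<close>. The sign is chosen so that its coefficients are the
  Pochhammer quotients below.
\<close>
definition one_minus_X_powr_neg :: "'a :: field_char_0 \<Rightarrow> 'a fps" where
  "one_minus_X_powr_neg s = fps_binomial (- s) oo (- fps_X)"

lemma one_minus_X_powr_neg_nth: "one_minus_X_powr_neg s $ n = pochhammer s n / fact n"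
proof -
  have "one_minus_X_powr_neg s = fps_binomial (- s) oo (fps_const (-1) * fps_X)"
    by (simp add: one_minus_X_powr_neg_def flip: fps_const_neg)
  thus ?thesis
    by (simp add: gbinomial_pochhammer flip: power_mult_distrib)
qed

lemma one_minus_X_powr_neg_add:
  "one_minus_X_powr_neg (s + t) = one_minus_X_powr_neg s * one_minus_X_powr_neg t"
  using fps_binomial_add_mult[of "- s" "- t"]
  by (simp add: one_minus_X_powr_neg_def fps_compose_mult_distrib)

lemma one_minus_X_powr_neg_of_nat_mult:
  "one_minus_X_powr_neg (of_nat k * s) = one_minus_X_powr_neg s ^ k"
  using fps_binomial_power[of "-s" k]
  by (simp add: one_minus_X_powr_neg_def fps_compose_power)

lemma one_minus_X_powr_neg_2: "one_minus_X_powr_neg 2 * (1 - fps_X) ^ 2 = 1"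
proof -
  have "one_minus_X_powr_neg (- 2) = ((1 + fps_X) ^ 2 oo (- fps_X) :: 'a fps)"
    using fps_binomial_of_nat[of 2, where ?'a = 'a] by (simp add: one_minus_X_powr_neg_def)
  also have "\<dots> = (1 - fps_X) ^ 2"
    by (simp add: fps_compose_power[symmetric] fps_compose_add_distrib)
  finally show ?thesis
    using one_minus_X_powr_neg_add[of 2 "-2 :: 'a"] by (simp add: one_minus_X_powr_neg_def)
qed

text \<open>
  The formal counterpart of
  \<open>1 - 2 x t + t\<^sup>2 = (1 - t)\<^sup>2 (1 + 4 z t / (1 - t)\<^sup>2)\<close> for \<open>x = 1 - 2 z\<close>: the series \<open>B\<close> is
  \<open>4 z t / (1 - t)\<^sup>2\<close>.
\<close>
lemma gegenbauer_generating_series_factorisation: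
  fixes \<alpha> z :: "'a :: field_char_0"
  defines "B \<equiv> fps_const (4 * z) * fps_X * one_minus_X_powr_neg 2"
  shows "fps_binomial (- \<alpha>) oo (fps_X ^ 2 - fps_const (2 * (1 - 2 * z)) * fps_X)
           = one_minus_X_powr_neg (2 * \<alpha>) * (fps_binomial (- \<alpha>) oo B)"
proof -
  \<comment> \<open>\<open>1 + ?Q = (1 - X)\<^sup>2\<close>; writing \<open>?Q\<close> in this shape makes it a product of two factors \<open>1 - X\<close>.\<close>
  let ?Q = "- fps_X + - fps_X + - fps_X * - fps_X :: 'a fps"
  have "fps_binomial (- \<alpha>) oo ?Q = one_minus_X_powr_neg \<alpha> * one_minus_X_powr_neg \<alpha>"
    by (subst fps_binomial_compose_mult) (simp_all add: one_minus_X_powr_neg_def)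
  also have "\<dots> = one_minus_X_powr_neg (2 * \<alpha>)"
    by (simp add: one_minus_X_powr_neg_add[symmetric])
  finally have Q: "fps_binomial (- \<alpha>) oo ?Q = one_minus_X_powr_neg (2 * \<alpha>)" .
  have const: "fps_const (2 * (1 - 2 * z)) = 2 - fps_const (4 * z)"
    by (simp add: fps_eq_iff algebra_simps numeral_fps_const)
  have "fps_X ^ 2 - fps_const (2 * (1 - 2 * z)) * fps_X = ?Q + B + ?Q * B"
    using one_minus_X_powr_neg_2[where ?'a = 'a] unfolding B_def const by algebra
  thus ?thesis
    by (subst Q[symmetric]) (simp add: B_def fps_binomial_compose_mult)
qed

text \<open>
  The \<open>k\<close>-th term of the binomial series in \<open>B\<close> contributes
  \<open>(4 z)\<^sup>k t\<^sup>k (1 - t) powr (- 2 \<alpha> - 2 k)\<close>, of which the coefficient of \<open>t\<^sup>m\<close> is taken.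
\<close>
lemma gegenbauer_1_minus_2z:
  fixes \<alpha> z :: "'a :: field_char_0"
  shows "gegenbauer m \<alpha> (1 - 2 * z)
           = (\<Sum>k\<le>m. (- \<alpha> gchoose k) * (4 * z) ^ k
                      * (pochhammer (2 * \<alpha> + 2 * of_nat k) (m - k) / fact (m - k)))"
proof -
  let ?E = one_minus_X_powr_neg
  have "?E (2 * \<alpha>) * (fps_const (4 * z) * fps_X * ?E 2) ^ k
          = fps_const ((4 * z) ^ k) * (fps_X ^ k * ?E (2 * \<alpha> + 2 * of_nat k))" for k
    using one_minus_X_powr_neg_of_nat_mult[of k "2 :: 'a"]
    by (simp add: power_mult_distrib one_minus_X_powr_neg_add fps_const_power mult_ac)
  thus ?thesis
    unfolding gegenbauer_def gegenbauer_generating_series_factorisation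
    by (subst fps_mult_compose_nth)
       (auto simp: fps_X_power_mult_nth one_minus_X_powr_neg_nth intro!: sum.cong)
qed

section \<open>Gegenbauer polynomials as hypergeometric polynomials\<close>

text \<open>
  Both sides reduce to \<open>pochhammer (2 * \<alpha>) (m + k)\<close>, split in two ways: after \<open>2 k\<close> factors, where
  the duplication formula removes \<open>4 ^ k * pochhammer \<alpha> k\<close>, and after \<open>m\<close> factors.
\<close>
lemma gegenbauer_coeff_eq_hypergeo_coeff:
  fixes \<alpha> :: "'a :: field_char_0"
  assumes "k \<le> m" and nz: "pochhammer (\<alpha> + 1 / 2) k \<noteq> 0"
  shows "(- \<alpha> gchoose k) * 4 ^ k * (pochhammer (2 * \<alpha> + 2 * of_nat k) (m - k) / fact (m - k))
       = pochhammer (2 * \<alpha>) m / fact m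
           * fps_hypergeo [- of_nat m, of_nat m + 2 * \<alpha>] [\<alpha> + 1 / 2] 1 $ k"
proof -
  have "pochhammer (2 * \<alpha>) (2 * k) * pochhammer (2 * \<alpha> + 2 * of_nat k) (m - k)
          = pochhammer (2 * \<alpha>) (m + k)"
    using pochhammer_product'[of "2 * \<alpha>" "2 * k" "m - k"] assms(1)
    by (simp add: algebra_simps)
  also have "\<dots> = pochhammer (2 * \<alpha>) m * pochhammer (of_nat m + 2 * \<alpha>) k"
    using pochhammer_product'[of "2 * \<alpha>" m k] by (simp add: add.commute)
  finally have up: "4 ^ k * pochhammer \<alpha> k * pochhammer (\<alpha> + 1 / 2) k
                      * pochhammer (2 * \<alpha> + 2 * of_nat k) (m - k)
                    = pochhammer (2 * \<alpha>) m * pochhammer (of_nat m + 2 * \<alpha>) k"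
    by (simp add: pochhammer_double power_mult)
  have "pochhammer (- of_nat m :: 'a) k = (-1) ^ k * fact k * of_nat (m choose k)"
    by (simp add: binomial_gbinomial gbinomial_pochhammer flip: power_mult_distrib)
  also have "of_nat (m choose k) = (fact m / (fact k * fact (m - k)) :: 'a)"
    by (rule binomial_fact[OF assms(1)])
  finally have down: "pochhammer (- of_nat m :: 'a) k = (-1) ^ k * fact m / fact (m - k)"
    by simp
  have "(- \<alpha> gchoose k) * 4 ^ k * (pochhammer (2 * \<alpha> + 2 * of_nat k) (m - k) / fact (m - k))
     = (-1) ^ k * (4 ^ k * pochhammer \<alpha> k * pochhammer (\<alpha> + 1 / 2) k
                      * pochhammer (2 * \<alpha> + 2 * of_nat k) (m - k))
         / (pochhammer (\<alpha> + 1 / 2) k * fact k * fact (m - k))"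
    using nz by (simp add: gbinomial_pochhammer)
  also have "\<dots> = pochhammer (2 * \<alpha>) m / fact m
           * fps_hypergeo [- of_nat m, of_nat m + 2 * \<alpha>] [\<alpha> + 1 / 2] 1 $ k"
    unfolding up by (simp add: down mult_ac)
  finally show ?thesis .
qed

text \<open>
  The hypothesis on \<open>\<alpha>\<close> says that no denominator of the hypergeometric series vanishes.
\<close>
lemma gegenbauer_eq_hypergeo:
  fixes \<alpha> z :: complex
  assumes "\<And>n. \<alpha> + 1 / 2 + of_nat n \<noteq> 0"
  shows "gegenbauer m \<alpha> (1 - 2 * z)
           = pochhammer (2 * \<alpha>) m / fact m * hyp2F1 (- of_nat m) (of_nat m + 2 * \<alpha>) (\<alpha> + 1 / 2) z"
proof -
  define H where "H = fps_hypergeo [- of_nat m, of_nat m + 2 * \<alpha>] [\<alpha> + 1 / 2] 1"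
  have nz: "pochhammer (\<alpha> + 1 / 2) k \<noteq> 0" for k
    using assms by (auto simp: pochhammer_eq_0_iff add_eq_0_iff2)
  have "hyp2F1 (- of_nat m) (of_nat m + 2 * \<alpha>) (\<alpha> + 1 / 2) z = (\<Sum>k. H $ k * z ^ k)"
    by (simp add: hyp2F1_eq_eval_fps_hypergeo eval_fps_def H_def)
  also have "\<dots> = (\<Sum>k\<le>m. H $ k * z ^ k)"
    by (rule suminf_finite) (auto simp: H_def pochhammer_of_nat_eq_0_iff)
  finally have sum: "hyp2F1 (- of_nat m) (of_nat m + 2 * \<alpha>) (\<alpha> + 1 / 2) z = (\<Sum>k\<le>m. H $ k * z ^ k)" .
  show ?thesis
    unfolding sum gegenbauer_1_minus_2z sum_distrib_left
  proof (rule sum.cong[OF refl])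
    fix k assume "k \<in> {..m}"
    hence "k \<le> m" by simp
    have "(- \<alpha> gchoose k) * (4 * z) ^ k * (pochhammer (2 * \<alpha> + 2 * of_nat k) (m - k) / fact (m - k))
        = ((- \<alpha> gchoose k) * 4 ^ k * (pochhammer (2 * \<alpha> + 2 * of_nat k) (m - k) / fact (m - k))) * z ^ k"
      by (simp only: power_mult_distrib mult_ac)
    also have "\<dots> = pochhammer (2 * \<alpha>) m / fact m * (H $ k * z ^ k)"
      by (subst gegenbauer_coeff_eq_hypergeo_coeff[OF \<open>k \<le> m\<close> nz]) (simp only: H_def mult.assoc)
    finally show "(- \<alpha> gchoose k) * (4 * z) ^ k * (pochhammer (2 * \<alpha> + 2 * of_nat k) (m - k) / fact (m - k))
        = pochhammer (2 * \<alpha>) m / fact m * (H $ k * z ^ k)" .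
  qed
qed

section \<open>The square of a hypergeometric series\<close>

text \<open>
  Differentiation multiplies a coefficient by its degree, which is \<open>n - j + 1\<close> before the shift by \<open>j\<close>.
  Keeping the factor \<open>X ^ j\<close> on the right lets the rule be iterated through higher derivatives without
  case distinctions: for \<open>n + 1 < j\<close> both coefficients vanish, for \<open>n + 1 = j\<close> the numerical factor does.
\<close>
lemma fps_X_power_mult_deriv_nth:
  "(fps_X ^ j * fps_deriv f) $ n = (of_nat n - of_nat j + 1) * (fps_X ^ j * f) $ (n+1 :: nat)"
  for f :: "'a :: field_char_0 fps"
proof (cases "n + 1 = j")
  case True
  have "(fps_X ^ j * fps_deriv f) $ n = 0"
    using True by (simp add: fps_X_power_mult_nth)
  moreover have "of_nat n - of_nat j + 1 = (0 :: 'a)"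
    using True by auto
  ultimately show ?thesis
    by simp
qed (auto simp: fps_X_power_mult_nth Suc_diff_le of_nat_diff)

text \<open>
  The coefficient of \<open>X ^ n\<close> is the two-term recurrence of the hypergeometric coefficients. The condition
  \<open>2 c = a + b + 1\<close> makes the coefficient \<open>c - (a + b + 1) X\<close> of \<open>f'\<close> a multiple of the derivative
  of \<open>X - X\<^sup>2\<close>.
\<close>
lemma hypergeo_ode:
  fixes a b c :: "'a :: field_char_0"
  defines "f \<equiv> fps_hypergeo [a, b] [c] 1"
  assumes c: "\<And>n. c + of_nat n \<noteq> 0" and abc: "2 * c = a + b + 1"
  shows "(fps_X - fps_X\<^sup>2) * fps_deriv (fps_deriv f) + fps_const c * (1 - 2 * fps_X) * fps_deriv f
           - fps_const (a * b) * f = 0"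
proof (rule fps_ext)
  fix n
  have "fps_deriv f $ n = (a + of_nat n) * (b + of_nat n) / (c + of_nat n) * f $ n"
    unfolding f_def using fps_hypergeo_rec[of "[a,b]" "[c]" 1 n]
    by (simp del: fps_hypergeo_nth of_nat_Suc add: add.commute)
  hence rec: "(c + of_nat n) * (of_nat (n + 1) * f $ (n + 1)) = (a + of_nat n) * (b + of_nat n) * f $ n"
    using c[of n] by (simp add: field_simps)
  have "((fps_X - fps_X\<^sup>2) * fps_deriv (fps_deriv f)) $ n
          = of_nat n * (of_nat (n + 1) * f $ (n + 1)) - of_nat n * (of_nat n - 1) * f $ n"
  proof -
    note D = fps_X_power_mult_deriv_nth
    have "(fps_X * fps_deriv (fps_deriv f)) $ n = of_nat n * (of_nat (n + 1) * f $ (n + 1))"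
      using D[of 1 "fps_deriv f" n] by simp
    moreover have "(fps_X\<^sup>2 * fps_deriv (fps_deriv f)) $ n = of_nat n * (of_nat n - 1) * f $ n"
      using D[of 2 "fps_deriv f" n] D[of 2 f "n + 1"] by (simp add: fps_X_power_mult_nth)
    ultimately show ?thesis
      by (simp add: left_diff_distrib)
  qed
  moreover have "(fps_const c * (1 - 2 * fps_X) * fps_deriv f) $ n
          = c * (of_nat (n + 1) * f $ (n + 1)) - 2 * c * of_nat n * f $ n"
    by (cases n) (simp_all add: ring_distribs algebra_simps numeral_fps_const)
  ultimately show "((fps_X - fps_X\<^sup>2) * fps_deriv (fps_deriv f) + fps_const c * (1 - 2 * fps_X) * fps_deriv f
           - fps_const (a * b) * f) $ n = 0 $ n"
    using rec abc by (simp only: fps_sub_nth fps_add_nth fps_mult_left_const_nth fps_zero_nth) algebra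
qed

text \<open>
  Let \<open>E\<close> be the given equation (with \<open>k = a b\<close>) and \<open>E'\<close> its derivative. After substituting the
  derivatives of \<open>w = f\<^sup>2\<close>, the left-hand side is the combination
  \<open>2 p f E' + (6 p f' + (4 c - 2) p' f) E\<close>, where \<open>p'' = - 2\<close> enters through \<open>E'\<close>.
\<close>
lemma hypergeo_square_ode:
  fixes f :: "'a :: field_char_0 fps" and c k :: 'a
  defines "w \<equiv> f\<^sup>2" and "p \<equiv> fps_X - fps_X\<^sup>2" and "p' \<equiv> 1 - 2 * fps_X"
  assumes ode: "p * fps_deriv (fps_deriv f) + fps_const c * p' * fps_deriv f - fps_const k * f = 0"
  shows "p\<^sup>2 * fps_deriv (fps_deriv (fps_deriv w)) + 3 * fps_const c * p * p' * fps_deriv (fps_deriv w)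
           - (2 * fps_const c + 4 * fps_const k) * p * fps_deriv w
           - (1 - 2 * fps_const c) * fps_const c * p'\<^sup>2 * fps_deriv w
           + 2 * fps_const k * (1 - 2 * fps_const c) * p' * w = 0"
proof -
  have dp: "fps_deriv p = p'" "fps_deriv p' = - 2"
    by (simp_all add: p_def p'_def power2_eq_square)
  have ode': "p * fps_deriv (fps_deriv (fps_deriv f)) + p' * fps_deriv (fps_deriv f)
      + fps_const c * p' * fps_deriv (fps_deriv f) - 2 * fps_const c * fps_deriv f
      - fps_const k * fps_deriv f = 0"
    using arg_cong[OF ode, of fps_deriv] by (simp add: dp algebra_simps)
  have w1: "fps_deriv w = 2 * (f * fps_deriv f)"
    by (simp add: w_def power2_eq_square)
  have w2: "fps_deriv (fps_deriv w) = 2 * ((fps_deriv f)\<^sup>2 + f * fps_deriv (fps_deriv f))"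
    unfolding w1 by (simp add: power2_eq_square)
  have w3: "fps_deriv (fps_deriv (fps_deriv w))
              = 2 * (3 * fps_deriv f * fps_deriv (fps_deriv f) + f * fps_deriv (fps_deriv (fps_deriv f)))"
    unfolding w2 by (simp add: power2_eq_square algebra_simps)
  show ?thesis
    unfolding w3 unfolding w2 unfolding w1 unfolding w_def using ode ode' by algebra
qed

text \<open>
  The coefficient of \<open>X ^ n\<close> in the third-order equation. Every term has the form
  \<open>X ^ i\<close> times a derivative of order \<open>d\<close> with \<open>- 1 \<le> i - d \<le> 1\<close>, so only three consecutive
  coefficients of \<open>w\<close> occur.
\<close>
lemma hypergeo_square_ode_coeff:
  fixes w :: "'a :: field_char_0 fps" and c k :: 'a
  defines "p \<equiv> fps_X - fps_X\<^sup>2" and "p' \<equiv> 1 - 2 * fps_X"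
  assumes ode: "p\<^sup>2 * fps_deriv (fps_deriv (fps_deriv w)) + 3 * fps_const c * p * p' * fps_deriv (fps_deriv w)
           - (2 * fps_const c + 4 * fps_const k) * p * fps_deriv w
           - (1 - 2 * fps_const c) * fps_const c * p'\<^sup>2 * fps_deriv w
           + 2 * fps_const k * (1 - 2 * fps_const c) * p' * w = 0"
    and n: "n \<ge> 1"
  defines "s \<equiv> of_nat n"
  shows "(s + 1) * (s + c) * (s + 2 * c - 1) * w $ (n + 1)
           = (2 * s * (s - 1) * (s - 2) + 9 * c * s * (s - 1) + (2 * c + 4 * k) * s
               - 4 * (1 - 2 * c) * c * s - 2 * k * (1 - 2 * c)) * w $ n
             - (s + 2 * c - 2) * ((s - 1)\<^sup>2 + 2 * (s - 1) * (2 * c - 1) + 4 * k) * w $ (n - 1)"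
proof -
  define w1 where "w1 = fps_deriv w"
  define w2 where "w2 = fps_deriv w1"
  define w3 where "w3 = fps_deriv w2"
  note D = fps_X_power_mult_deriv_nth
  have X0: "(fps_X * w) $ n = w $ (n - 1)"
    using n by simp
  have X1: "w1 $ n = (s + 1) * w $ (n + 1)"
    "(fps_X * w1) $ n = s * w $ n"
    "(fps_X\<^sup>2 * w1) $ n = (s - 1) * w $ (n - 1)"
    using D[of 0 w n] D[of 1 w n] D[of 2 w n] n
    by (simp_all add: w1_def s_def fps_X_power_mult_nth add.commute)
  have X2: "(fps_X * w2) $ n = s * (s + 1) * w $ (n + 1)"
    "(fps_X\<^sup>2 * w2) $ n = (s - 1) * s * w $ n"
    "(fps_X ^ 3 * w2) $ n = (s - 2) * (s - 1) * w $ (n - 1)"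
    using D[of 1 w1 n] D[of 1 w "n + 1"] D[of 2 w1 n] D[of 2 w "n + 1"] D[of 3 w1 n] D[of 3 w "n + 1"] n
    by (simp_all add: w2_def w1_def s_def fps_X_power_mult_nth)
  have X3: "(fps_X\<^sup>2 * w3) $ n = (s - 1) * s * (s + 1) * w $ (n + 1)"
    "(fps_X ^ 3 * w3) $ n = (s - 2) * (s - 1) * s * w $ n"
    "(fps_X ^ 4 * w3) $ n = (s - 3) * (s - 2) * (s - 1) * w $ (n - 1)"
    using D[of 2 w2 n] D[of 2 w1 "n + 1"] D[of 2 w "n + 2"] D[of 3 w2 n] D[of 3 w1 "n + 1"]
      D[of 3 w "n + 2"] D[of 4 w2 n] D[of 4 w1 "n + 1"] D[of 4 w "n + 2"] n
    by (simp_all add: w3_def w2_def w1_def s_def fps_X_power_mult_nth)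
  have "fps_X\<^sup>2 * w3 - fps_const 2 * (fps_X ^ 3 * w3) + fps_X ^ 4 * w3
          + fps_const (3 * c) * (fps_X * w2 - fps_const 3 * (fps_X\<^sup>2 * w2) + fps_const 2 * (fps_X ^ 3 * w2))
          - fps_const (2 * c + 4 * k) * (fps_X * w1 - fps_X\<^sup>2 * w1)
          - fps_const ((1 - 2 * c) * c) * (w1 - fps_const 4 * (fps_X * w1) + fps_const 4 * (fps_X\<^sup>2 * w1))
          + fps_const (2 * k * (1 - 2 * c)) * (w - fps_const 2 * (fps_X * w)) = 0"
    using ode unfolding p_def p'_def w1_def[symmetric] w2_def[symmetric] w3_def[symmetric]
      fps_const_mult[symmetric] fps_const_add[symmetric] fps_const_sub[symmetric]
      numeral_fps_const[symmetric] fps_const_1_eq_1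
    by algebra
  from arg_cong[OF this, of "\<lambda>f. f $ n"] show ?thesis
    by (simp only: fps_add_nth fps_sub_nth fps_mult_left_const_nth X0 X1 X2 X3 fps_zero_nth) algebra
qed

section \<open>The recurrence for the squared Gegenbauer polynomial\<close>

text \<open>
  The factor \<open>pochhammer (- of_nat m) k\<close> vanishes for \<open>k > m\<close>, so the series is a polynomial.
\<close>
lemma fps_conv_radius_terminating_hypergeo:
  fixes m :: nat and b c :: complex
  defines "H \<equiv> fps_hypergeo [- of_nat m, b] [c] 1"
  shows "fps_conv_radius H = \<infinity>"
proof -
  have "H $ k = 0" if "k > m" for k
    using that by (simp add: H_def pochhammer_of_nat_eq_0_iff)
  hence "H = fps_of_poly (Abs_poly (fps_nth H))"
    by (intro fps_ext) (simp add: coeff_Abs_poly[of m])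
  thus ?thesis
    by (metis fps_conv_radius_fps_of_poly)
qed

text \<open>
  The specialisation \<open>a = - m\<close>, \<open>b = m + 2 \<alpha>\<close>, \<open>c = \<alpha> + 1 / 2\<close> of the coefficient relation above,
  multiplied by \<open>2\<close>; the last multiplier \<open>(n - 1 + 2 a) (n - 1 + 2 b)\<close> splits into linear factors.
\<close>
lemma hypergeo_square_recurrence:
  fixes m \<alpha> :: "'a :: field_char_0"
  defines "w \<equiv> (fps_hypergeo [- m, m + 2 * \<alpha>] [\<alpha> + 1 / 2] 1)\<^sup>2"
  assumes nz: "\<And>n. \<alpha> + 1 / 2 + of_nat n \<noteq> 0" and n: "n \<ge> 1"
  defines "s \<equiv> of_nat n"
  shows "(s + 1) * (2 * \<alpha> + s) * (2 * \<alpha> + 2 * s + 1) * w $ (n + 1)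
           = (s * (2 * \<alpha> * (8 * \<alpha> - 3) - 8 * m ^ 2 - 16 * \<alpha> * m + 1)
                - 8 * \<alpha> * m * (2 * \<alpha> + m) + 4 * s ^ 3 + 3 * (6 * \<alpha> - 1) * s ^ 2) * w $ n
             - 2 * (- 2 * m + s - 1) * (2 * \<alpha> + s - 1) * (4 * \<alpha> + 2 * m + s - 1) * w $ (n - 1)"
proof -
  have "2 * (\<alpha> + 1 / 2) = - m + (m + 2 * \<alpha>) + 1"
    by (simp add: algebra_simps)
  note ode = hypergeo_ode[OF nz this]
  note hypergeo_square_ode_coeff[OF hypergeo_square_ode[OF ode] n, folded w_def s_def]
  thus ?thesis by algebra
qed

theorem corollary2p6:
  fixes m :: nat and \<alpha> :: real and u :: "nat \<Rightarrow> real" and z :: complex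
  assumes "\<alpha> > 0"
    and "norm z < 1"
    and "u 0 = 1"
    and "u 1 = - 4 * real m * (2 * \<alpha> + real m) / (2 * \<alpha> + 1)"
    and "\<And>n::nat. n \<ge> 1 \<Longrightarrow>
      u (n + 1) =
        (real n * (2 * \<alpha> * (8 * \<alpha> - 3) - 8 * real m ^ 2 - 16 * \<alpha> * real m + 1)
            - 8 * \<alpha> * real m * (2 * \<alpha> + real m) + 4 * real n ^ 3 + 3 * (6 * \<alpha> - 1) * real n ^ 2)
          / ((real n + 1) * (2 * \<alpha> + real n) * (2 * \<alpha> + 2 * real n + 1)) * u n
        - 2 * (- 2 * real m + real n - 1) * (2 * \<alpha> + real n - 1) * (4 * \<alpha> + 2 * real m + real n - 1)
          / ((real n + 1) * (2 * \<alpha> + real n) * (2 * \<alpha> + 2 * real n + 1)) * u (n - 1)"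
  shows "(gegenbauer m (complex_of_real \<alpha>) (1 - 2 * z)) ^ 2
           = complex_of_real ((pochhammer (2 * \<alpha>) m / fact m) ^ 2)
             * (hyp2F1 (- of_nat m) (of_nat m + 2 * complex_of_real \<alpha>)
                  (complex_of_real \<alpha> + 1 / 2) z) ^ 2
         \<and> summable (\<lambda>n. complex_of_real (u n) * z ^ n)
         \<and> complex_of_real ((pochhammer (2 * \<alpha>) m / fact m) ^ 2)
             * (hyp2F1 (- of_nat m) (of_nat m + 2 * complex_of_real \<alpha>)
                  (complex_of_real \<alpha> + 1 / 2) z) ^ 2
           = complex_of_real ((pochhammer (2 * \<alpha>) m / fact m) ^ 2)
             * (\<Sum>n. complex_of_real (u n) * z ^ n)"
proof -
  define A where "A = complex_of_real \<alpha>"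
  define M where "M = (of_nat m :: complex)"
  define H where "H = fps_hypergeo [- M, M + 2 * A] [A + 1 / 2] 1"
  have nz: "A + 1 / 2 + of_nat n \<noteq> 0" for n
  proof -
    have "Re (A + 1 / 2 + of_nat n) > 0"
      using assms(1) by (simp add: A_def)
    thus ?thesis by force
  qed

  \<comment> \<open>\<open>u\<close> and the coefficients of \<open>H\<^sup>2\<close> satisfy the same recurrence with the same two initial values,
      and the leading coefficient \<open>D\<close> of the recurrence is positive.\<close>
  have coeff: "complex_of_real (u n) = (H\<^sup>2) $ n" for n
  proof (induction n rule: less_induct)
    case (less n)
    consider "n = 0" | "n = 1" | j where "n = j + 1" "j \<ge> 1"
      by (metis One_nat_def Suc_eq_plus1 less_one linorder_not_less not0_implies_Suc)
    thus ?case
    proof cases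
      case 1
      thus ?thesis
        by (simp add: assms(3) H_def power2_eq_square)
    next
      case 2
      have "(H\<^sup>2) $ 1 = 2 * H $ 1"
        by (simp add: power2_eq_square fps_mult_nth_1 H_def del: fps_hypergeo_nth)
      also have "H $ 1 = - M * (M + 2 * A) / (A + 1 / 2)"
        by (simp add: H_def)
      also have "2 * (- M * (M + 2 * A) / (A + 1 / 2)) = - 4 * M * (2 * A + M) / (2 * A + 1)"
        using nz[of 0] by (simp add: field_simps)
      also have "\<dots> = complex_of_real (u 1)"
        unfolding assms(4) A_def M_def by simp
      finally show ?thesis
        using 2 by simp
    next
      case 3
      define D where "D = (real j + 1) * (2 * \<alpha> + real j) * (2 * \<alpha> + 2 * real j + 1)"
      define P where "P = real j * (2 * \<alpha> * (8 * \<alpha> - 3) - 8 * real m ^ 2 - 16 * \<alpha> * real m + 1)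
            - 8 * \<alpha> * real m * (2 * \<alpha> + real m) + 4 * real j ^ 3 + 3 * (6 * \<alpha> - 1) * real j ^ 2"
      define Q where "Q = 2 * (- 2 * real m + real j - 1) * (2 * \<alpha> + real j - 1)
                            * (4 * \<alpha> + 2 * real m + real j - 1)"
      have "D > 0"
        using assms(1) by (simp add: D_def add_pos_nonneg)
      have "u n = P / D * u j - Q / D * u (j - 1)"
        using assms(5)[OF 3(2)] 3(1) unfolding D_def P_def Q_def by simp
      hence "D * u n = P * u j - Q * u (j - 1)"
        using \<open>D > 0\<close> by (simp add: field_simps)
      hence "complex_of_real D * complex_of_real (u n)
              = complex_of_real P * complex_of_real (u j) - complex_of_real Q * complex_of_real (u (j - 1))"
        by (metis of_real_diff of_real_mult)
      also have "\<dots> = complex_of_real P * (H\<^sup>2) $ j - complex_of_real Q * (H\<^sup>2) $ (j - 1)"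
        using less 3 by simp
      also have "\<dots> = complex_of_real D * (H\<^sup>2) $ n"
        using hypergeo_square_recurrence[of A j M, OF nz 3(2), folded H_def] 3(1)
        by (simp add: D_def P_def Q_def A_def M_def)
      finally show ?thesis
        using \<open>D > 0\<close> by simp
    qed
  qed

  have radius: "fps_conv_radius H = \<infinity>"
    unfolding H_def M_def by (rule fps_conv_radius_terminating_hypergeo)
  hence "fps_conv_radius (H\<^sup>2) = \<infinity>"
    using fps_conv_radius_power[of H 2] by simp
  hence "summable (\<lambda>n. (H\<^sup>2) $ n * z ^ n)"
    by (intro summable_fps) simp
  moreover have "hyp2F1 (- M) (M + 2 * A) (A + 1 / 2) z ^ 2 = (\<Sum>n. (H\<^sup>2) $ n * z ^ n)"
    using eval_fps_power[of z H 2] radius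
    by (simp add: hyp2F1_eq_eval_fps_hypergeo H_def[symmetric] eval_fps_def[of "H\<^sup>2"])
  moreover have "gegenbauer m A (1 - 2 * z)
      = pochhammer (2 * A) m / fact m * hyp2F1 (- M) (M + 2 * A) (A + 1 / 2) z"
    unfolding M_def by (rule gegenbauer_eq_hypergeo[OF nz])
  moreover have "pochhammer (2 * A) m / fact m = complex_of_real (pochhammer (2 * \<alpha>) m / fact m)"
    by (simp add: A_def flip: pochhammer_of_real)
  ultimately show ?thesis
    unfolding coeff A_def[symmetric] M_def[symmetric] by (simp add: power_mult_distrib power_divide)
qed

end
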